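(* Let $U_1,\dots,U_k,V_1,\dots,V_\ell$ be finite-dimensional vector spaces over $\mathbb{F}_p$ and let $\alpha : U_1\times\cdots\times U_k \times V_1\times\cdots\times V_\ell \to \mathbb{F}_p$ be a multilinear form. For $\delta > 0$ define $S_\delta = \{x_{[k]} \in U_1\times\cdots\times U_k : \operatorname{bias}(\alpha_{x_{[k]}}) \geq \delta\}$. Let $K=K(k)$ be as in the context. Suppose that for some $c > 0$ we have $|S_c| \geq c|U_1\times\cdots\times U_k|$. Then $S_{\tilde{c}}$ contains a multilinear variety of codimension at most $K(2 \log_p c^{-1} + 2)$, where $\tilde{c} = 2^{-2^{k+2}k}p^{-2^{k+1}k K} c^{2^{k+2}kK}$.
   Context: $\chi(a)=\exp(2\pi i a/p)$; for a multilinear form $\psi$ on $W_1\times\cdots\times W_j$, $\operatorname{bias}\psi = \frac{1}{|W_1|\cdots|W_j|}\sum_{w_i\in W_i}\chi(\psi(w_1,\dots,w_j))$. For $x_{[k]}=(x_1,\dots,x_k)\in U_1\times\cdots\times U_k$, $\alpha_{x_{[k]}} : V_1\times\cdots\times V_\ell\to\mathbb{F}_p$ is the multilinear form $y_{[\ell]}\mapsto\alpha(x_{[k]},y_{[\ell]})$. A multilinear variety in $U_1\times\cdots\times U_k$ is the common zero set of finitely many forms $\beta_i(x_{I_i})$, each $\beta_i$ multilinear in the variables indexed by a nonempty $I_i\subseteq[k]$; it has codimension at most $r$ if at most $r$ such forms define it; its density is its size divided by $|U_1\times\cdots\times U_k|$. $K=K(k)$ is a positive integer, depending only on $k$ (not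 on $p$), such that for every prime $p$ and all finite-dimensional $\mathbb{F}_p$-spaces $U_1,\dots,U_k$, every multilinear variety in $U_1\times\cdots\times U_k$ of density $c$ contains a multilinear variety of codimension at most $K(\log_p c^{-1}+1)$ (such $K$ exists by a theorem of Mili\'cevi\'c). *)

theory Defs
  imports "HOL-Number_Theory.Residues" Complex_Main
begin

abbreviation Fp :: "nat \<Rightarrow> int ring" where
  "Fp p \<equiv> residue_ring (int p)"

text \<open>The \<^const>\<open>monoid.mult\<close> and \<^const>\<open>monoid.one\<close> fields of a module record play no role.\<close>

definition fin_dim_space :: "nat \<Rightarrow> (int, 'a) module \<Rightarrow> bool" where
  "fin_dim_space p V \<longleftrightarrow>
     module (Fp p) V \<and>
     (\<exists>B. finite B \<and> B \<subseteq> carrier V \<and>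
        (\<forall>v\<in>carrier V. \<exists>a\<in>B \<rightarrow> carrier (Fp p).
            v = (\<Oplus>\<^bsub>V\<^esub>b\<in>B. a b \<odot>\<^bsub>V\<^esub> b)))"

text \<open>
  A point of the product of the spaces \<open>W i\<close>, \<open>i \<in> J\<close>, is an extensional function on \<open>J\<close>.
\<close>

abbreviation prod_space :: "nat set \<Rightarrow> (nat \<Rightarrow> (int, 'a) module) \<Rightarrow> (nat \<Rightarrow> 'a) set" where
  "prod_space J W \<equiv> (\<Pi>\<^sub>E i\<in>J. carrier (W i))"

definition multilinear_form ::
    "nat \<Rightarrow> nat set \<Rightarrow> (nat \<Rightarrow> (int, 'a) module) \<Rightarrow> ((nat \<Rightarrow> 'a) \<Rightarrow> int) \<Rightarrow> bool" where
  "multilinear_form p J W \<psi> \<longleftrightarrow>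
     \<psi> \<in> prod_space J W \<rightarrow> carrier (Fp p) \<and>
     (\<forall>w\<in>prod_space J W. \<forall>i\<in>J.
        (\<forall>u\<in>carrier (W i). \<forall>v\<in>carrier (W i).
           \<psi> (w(i := u \<oplus>\<^bsub>W i\<^esub> v)) = \<psi> (w(i := u)) \<oplus>\<^bsub>Fp p\<^esub> \<psi> (w(i := v))) \<and>
        (\<forall>a\<in>carrier (Fp p). \<forall>v\<in>carrier (W i).
           \<psi> (w(i := a \<odot>\<^bsub>W i\<^esub> v)) = a \<otimes>\<^bsub>Fp p\<^esub> \<psi> (w(i := v))))"

definition chi :: "nat \<Rightarrow> int \<Rightarrow> complex" where
  "chi p a = exp (2 * of_real pi * \<i> * of_int a / of_nat p)"

definition bias ::
    "nat \<Rightarrow> nat set \<Rightarrow> (nat \<Rightarrow> (int, 'a) module) \<Rightarrow> ((nat \<Rightarrow> 'a) \<Rightarrow> int) \<Rightarrow> complex" where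
  "bias p J W \<psi> = (\<Sum>w\<in>prod_space J W. chi p (\<psi> w)) / of_nat (\<Prod>i\<in>J. card (carrier (W i)))"

text \<open>
  The bias of a multilinear form in at least one variable is a nonnegative real number, so
  that \<^const>\<open>Re\<close> below is only a coercion.
\<close>

definition bias_set ::
    "nat \<Rightarrow> nat \<Rightarrow> (nat \<Rightarrow> (int, 'a) module) \<Rightarrow> nat \<Rightarrow> (nat \<Rightarrow> (int, 'b) module) \<Rightarrow>
     ((nat \<Rightarrow> 'a) \<Rightarrow> (nat \<Rightarrow> 'b) \<Rightarrow> int) \<Rightarrow> real \<Rightarrow> (nat \<Rightarrow> 'a) set" where
  "bias_set p k U l V \<alpha> \<delta> = {x \<in> prod_space {1..k} U. Re (bias p {1..l} V (\<alpha> x)) \<ge> \<delta>}"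

text \<open>
  \<open>variety_by p k U d Z\<close>: the set \<open>Z\<close> is the common zero set of \<open>d\<close> forms, the form with number
  \<open>j\<close> being multilinear in the variables with indices in \<open>I j\<close>.
\<close>

definition variety_by ::
    "nat \<Rightarrow> nat \<Rightarrow> (nat \<Rightarrow> (int, 'a) module) \<Rightarrow> nat \<Rightarrow> (nat \<Rightarrow> 'a) set \<Rightarrow> bool" where
  "variety_by p k U d Z \<longleftrightarrow>
     (\<exists>(I :: nat \<Rightarrow> nat set) (\<beta> :: nat \<Rightarrow> (nat \<Rightarrow> 'a) \<Rightarrow> int).
        (\<forall>j<d. I j \<noteq> {} \<and> I j \<subseteq> {1..k} \<and> multilinear_form p (I j) U (\<beta> j)) \<and>
        Z = {x \<in> prod_space {1..k} U. \<forall>j<d. \<beta> j (restrict x (I j)) = \<zero>\<^bsub>Fp p\<^esub>})"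

definition multilinear_variety ::
    "nat \<Rightarrow> nat \<Rightarrow> (nat \<Rightarrow> (int, 'a) module) \<Rightarrow> (nat \<Rightarrow> 'a) set \<Rightarrow> bool" where
  "multilinear_variety p k U Z \<longleftrightarrow> (\<exists>d. variety_by p k U d Z)"

definition variety_of_codim_le ::
    "nat \<Rightarrow> nat \<Rightarrow> (nat \<Rightarrow> (int, 'a) module) \<Rightarrow> real \<Rightarrow> (nat \<Rightarrow> 'a) set \<Rightarrow> bool" where
  "variety_of_codim_le p k U r Z \<longleftrightarrow> (\<exists>d. real d \<le> r \<and> variety_by p k U d Z)"

definition density ::
    "nat \<Rightarrow> (nat \<Rightarrow> (int, 'a) module) \<Rightarrow> (nat \<Rightarrow> 'a) set \<Rightarrow> real" where
  "density k U Z = real (card Z) / real (card (prod_space {1..k} U))"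

text \<open>
  The admissible values of \<open>K(k)\<close>. One cannot quantify over types inside a formula; since
  finite-dimensional spaces over a prime field are finite, each of them is isomorphic to one
  whose vectors are natural numbers, so the type \<^typ>\<open>(int, nat) module\<close> covers all of them.
\<close>

definition variety_constant :: "nat \<Rightarrow> nat \<Rightarrow> bool" where
  "variety_constant k K \<longleftrightarrow>
     K > 0 \<and>
     (\<forall>p. prime p \<longrightarrow>
       (\<forall>(U :: nat \<Rightarrow> (int, nat) module) Z.
          (\<forall>i\<in>{1..k}. fin_dim_space p (U i)) \<longrightarrow> multilinear_variety p k U Z \<longrightarrow>
          (\<exists>Y. Y \<subseteq> Z \<and>
             variety_of_codim_le p k U (real K * (log (real p) (1 / density k U Z) + 1)) Y)))"

end

theory Submission
  imports Defs
begin

text \<open>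
  The value \<open>f x\<close> of the bias at \<open>x\<close> is the proportion of those \<open>z\<close> for which \<open>x\<close> lies in the
  multilinear variety \<open>Z\<^sub>z\<close> given by \<open>\<alpha>(x, z\<^sub>1, \<dots>, z\<^bsub>l-1\<^esub>, \<cdot>) = 0\<close>. Averaging over \<open>z\<close> yields a
  \<open>Z\<^sub>z\<close> of density at least \<open>c\<^sup>2/2 \<ge> c\<^sup>2/p\<close> in which the points with \<open>f x < e\<close> have density at
  most \<open>2 e / c\<^sup>2\<close>. It contains a variety \<open>Y\<close> of codimension \<open>d \<le> K (2 log\<^sub>p (1/c) + 2)\<close>. Along
  each coordinate, \<open>f (x + x') \<ge> f x * f x'\<close>. So a point of \<open>Y\<close> with \<open>f x < e ^ 2^k\<close> forces,
  one coordinate at a time, a proportion of at least \<open>(2 p ^ d) powr -k\<close> of all points to lie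
  in \<open>Y\<close> and to satisfy \<open>f < e\<close>, which is too many for \<open>e = 2 powr -4k * p powr -2kK * c ^ 4kK\<close>.
\<close>

section \<open>Character sums of additive forms\<close>

text \<open>Models the dependence of a multilinear form on a single coordinate. Values are integer
  representatives in \<open>{0..<int p}\<close>, so vanishing is plain equality with 0 and the
  values can be fed directly to \<open>chi\<close>.\<close>

definition additive_form :: "nat \<Rightarrow> (int, 'a) module \<Rightarrow> ('a \<Rightarrow> int) \<Rightarrow> bool" where
  "additive_form p V A \<longleftrightarrow> A \<in> carrier V \<rightarrow> {0..<int p} \<and>
     (\<forall>u\<in>carrier V. \<forall>v\<in>carrier V. A (u \<oplus>\<^bsub>V\<^esub> v) = (A u + A v) mod int p)"

lemma chi_add: "chi p (a + b) = chi p a * chi p b"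
  by (simp add: chi_def flip: exp_add) (simp add: algebra_simps add_divide_distrib)

lemma chi_eq_cis: "chi p a = cis (2 * pi * of_int a / of_nat p)"
  by (simp add: chi_def cis_conv_exp mult_ac)

lemma chi_eq_1_iff:
  assumes "p > 0"
  shows "chi p a = 1 \<longleftrightarrow> int p dvd a"
proof
  assume "chi p a = 1"
  then have "cos (2 * pi * of_int a / real p) = 1"
    by (simp add: chi_eq_cis complex_eq_iff)
  then obtain n :: int where "2 * pi * of_int a / real p = of_int n * 2 * pi"
    unfolding cos_one_2pi_int by auto
  with assms have "real_of_int a = of_int n * of_int (int p)"
    by (simp add: field_simps)
  then have "a = n * int p" by (metis of_int_eq_iff of_int_mult)
  then show "int p dvd a" by simp
next
  assume "int p dvd a"
  then obtain n where "a = int p * n" by auto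
  with assms have "chi p a = cis (2 * pi * of_int n)"
    by (simp add: chi_eq_cis field_simps)
  then show "chi p a = 1" by simp
qed

lemma chi_0 [simp]: "chi p 0 = 1"
  by (simp add: chi_def)

lemma chi_mod:
  assumes "p > 0"
  shows "chi p (a mod int p) = chi p a"
proof -
  have "chi p a = chi p (a div int p * int p + a mod int p)" by simp
  also have "\<dots> = chi p (a mod int p)"
    unfolding chi_add using chi_eq_1_iff[OF assms, of "a div int p * int p"] by simp
  finally show ?thesis ..
qed

lemma additive_form_add:
  assumes "p > 0" "additive_form p V A" "additive_form p V B"
  shows "additive_form p V (\<lambda>v. (A v + B v) mod int p)"
proof -
  have "((A u + A v) mod int p + (B u + B v) mod int p) mod int p =
      ((A u + B u) mod int p + (A v + B v) mod int p) mod int p" for u v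
    by (simp add: mod_simps) (simp add: algebra_simps)
  with assms show ?thesis unfolding additive_form_def by auto
qed

lemma additive_form_minus:
  assumes "abelian_group V" "additive_form p V A" "u \<in> carrier V" "v \<in> carrier V"
  shows "A (u \<ominus>\<^bsub>V\<^esub> v) = (A u - A v) mod int p"
proof -
  interpret abelian_group V by fact
  have "A ((u \<ominus>\<^bsub>V\<^esub> v) \<oplus>\<^bsub>V\<^esub> v) = (A (u \<ominus>\<^bsub>V\<^esub> v) + A v) mod int p" "A (u \<ominus>\<^bsub>V\<^esub> v) \<in> {0..<int p}"
    using assms(2-4) unfolding additive_form_def by auto
  moreover have "(u \<ominus>\<^bsub>V\<^esub> v) \<oplus>\<^bsub>V\<^esub> v = u"
    using assms(3,4) by (simp add: minus_eq a_assoc l_neg)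
  ultimately show ?thesis by (simp add: mod_simps)
qed

text \<open>Orthogonality of characters: if \<open>A u \<noteq> 0\<close>, translating the summation
  variable by \<open>u\<close> multiplies the sum by \<open>chi p (A u)\<close>, which differs from
  1, so the sum is 0.\<close>

lemma sum_chi_additive_form:
  assumes "p > 0" "abelian_group V" "finite (carrier V)" and A: "additive_form p V A"
  shows "(\<Sum>v\<in>carrier V. chi p (A v)) =
    (if \<forall>v\<in>carrier V. A v = 0 then of_nat (card (carrier V)) else 0)"
proof (cases "\<forall>v\<in>carrier V. A v = 0")
  case False
  interpret abelian_group V by fact
  from False obtain u where u: "u \<in> carrier V" "A u \<noteq> 0" by auto
  let ?S = "\<Sum>v\<in>carrier V. chi p (A v)"
  have "?S = (\<Sum>v\<in>carrier V. chi p (A (v \<oplus>\<^bsub>V\<^esub> u)))"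
    using u(1) by (intro sum.reindex_bij_witness[of _ "\<lambda>v. v \<oplus>\<^bsub>V\<^esub> u" "\<lambda>v. v \<ominus>\<^bsub>V\<^esub> u"])
      (auto simp: minus_eq a_assoc l_neg r_neg)
  also have "\<dots> = (\<Sum>v\<in>carrier V. chi p (A v) * chi p (A u))"
    using A u(1) assms(1) unfolding additive_form_def
    by (intro sum.cong) (auto simp: chi_mod chi_add)
  also have "\<dots> = ?S * chi p (A u)" by (simp add: sum_distrib_right)
  finally have "?S = 0 \<or> chi p (A u) = 1" by simp
  moreover have "A u \<in> {0..<int p}" using A u(1) unfolding additive_form_def by blast
  then have "\<not> int p dvd A u" using u(2) by (intro zdvd_not_zless) auto
  ultimately show ?thesis using False chi_eq_1_iff[OF assms(1)] by auto
qed auto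

text \<open>Isolates one coordinate of a sum over a product by resampling it. Exchanging
  \<open>x j\<close> with \<open>u\<close> is an involution on the pairs \<open>(x, u)\<close>,
  which removes the update from the summand.\<close>

lemma sum_PiE_fun_upd:
  fixes F :: "('i \<Rightarrow> 'a) \<Rightarrow> 'c::comm_semiring_1"
  assumes "j \<in> J"
  shows "(\<Sum>x\<in>Pi\<^sub>E J C. \<Sum>u\<in>C j. F (x(j := u))) = of_nat (card (C j)) * (\<Sum>x\<in>Pi\<^sub>E J C. F x)"
proof -
  have "(\<Sum>x\<in>Pi\<^sub>E J C. \<Sum>u\<in>C j. F (x(j := u))) = (\<Sum>(x, u)\<in>Pi\<^sub>E J C \<times> C j. F (x(j := u)))"
    by (simp add: sum.cartesian_product)
  also have "\<dots> = (\<Sum>(x, u)\<in>Pi\<^sub>E J C \<times> C j. F x)"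
    using assms
    by (intro sum.reindex_bij_witness[of _ "\<lambda>(x, u). (x(j := u), x j)" "\<lambda>(x, u). (x(j := u), x j)"])
      (auto simp: PiE_iff extensional_def)
  also have "\<dots> = of_nat (card (C j)) * (\<Sum>x\<in>Pi\<^sub>E J C. F x)"
    by (simp add: sum_distrib_left flip: sum.cartesian_product)
  finally show ?thesis .
qed

section \<open>Finite-dimensional spaces as finite modules\<close>

lemma fin_dim_space_abelian_group: "fin_dim_space p V \<Longrightarrow> abelian_group V"
  unfolding fin_dim_space_def module_def by simp

text \<open>Every vector is a combination of the finite set \<open>B\<close>. Restricting the
  coefficient functions to \<open>B\<close> makes them extensional, and there are finitely many of
  those.\<close>

lemma fin_dim_space_finite:
  assumes "fin_dim_space p V"
  shows "finite (carrier V)"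
proof -
  interpret module "Fp p" V using assms unfolding fin_dim_space_def by simp
  from assms obtain B where B: "finite B" "B \<subseteq> carrier V"
    "\<And>v. v \<in> carrier V \<Longrightarrow> \<exists>a\<in>B \<rightarrow> carrier (Fp p). v = (\<Oplus>\<^bsub>V\<^esub>b\<in>B. a b \<odot>\<^bsub>V\<^esub> b)"
    unfolding fin_dim_space_def by blast
  have "carrier V \<subseteq> (\<lambda>a. \<Oplus>\<^bsub>V\<^esub>b\<in>B. a b \<odot>\<^bsub>V\<^esub> b) ` (B \<rightarrow>\<^sub>E carrier (Fp p))"
  proof
    fix v assume "v \<in> carrier V"
    from B(3)[OF this] obtain a where a: "a \<in> B \<rightarrow> carrier (Fp p)" "v = (\<Oplus>\<^bsub>V\<^esub>b\<in>B. a b \<odot>\<^bsub>V\<^esub> b)"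
      by blast
    have "v = (\<Oplus>\<^bsub>V\<^esub>b\<in>B. restrict a B b \<odot>\<^bsub>V\<^esub> b)"
      unfolding a(2) using a(1) B(2) by (intro M.finsum_cong') (auto intro!: smult_closed)
    with a(1) show "v \<in> (\<lambda>a. \<Oplus>\<^bsub>V\<^esub>b\<in>B. a b \<odot>\<^bsub>V\<^esub> b) ` (B \<rightarrow>\<^sub>E carrier (Fp p))"
      by (intro image_eqI[of _ _ "restrict a B"]) auto
  qed
  moreover have "finite (carrier (Fp p))" by (simp add: residue_ring_def)
  ultimately show ?thesis using B(1) by (meson finite_subset finite_imageI finite_PiE)
qed

text \<open>The whole carrier serves as the spanning set, with coefficient 1 at \<open>v\<close> and
  0 elsewhere.\<close>

lemma finite_module_fin_dim_space:
  assumes "module (Fp p) V" "finite (carrier V)"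
  shows "fin_dim_space p V"
  unfolding fin_dim_space_def
proof (intro conjI exI[of _ "carrier V"] ballI bexI)
  interpret module "Fp p" V by fact
  fix v assume v: "v \<in> carrier V"
  define a where "a = (\<lambda>b. if b = v then \<one>\<^bsub>Fp p\<^esub> else \<zero>\<^bsub>Fp p\<^esub>)"
  show "a \<in> carrier V \<rightarrow> carrier (Fp p)" by (auto simp: a_def)
  have "(\<Oplus>\<^bsub>V\<^esub>b\<in>carrier V. a b \<odot>\<^bsub>V\<^esub> b) = (\<Oplus>\<^bsub>V\<^esub>b\<in>carrier V. if v = b then b else \<zero>\<^bsub>V\<^esub>)"
    by (intro M.finsum_cong') (auto simp: a_def smult_l_null)
  also have "\<dots> = v"
    using M.finsum_singleton[OF v assms(2), of "\<lambda>b. b"] by auto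
  finally show "v = (\<Oplus>\<^bsub>V\<^esub>b\<in>carrier V. a b \<odot>\<^bsub>V\<^esub> b)" ..
qed (use assms in auto)

text \<open>\<open>variety_constant\<close> speaks only about modules whose vectors are natural
  numbers. Since the carrier is finite, it injects into \<open>nat\<close>, and the module structure
  is transported along the injection.\<close>

lemma fin_dim_space_nat_copy:
  assumes "fin_dim_space p V"
  obtains W :: "(int, nat) module" and h where
    "fin_dim_space p W" "bij_betw h (carrier V) (carrier W)"
    "\<And>u v. u \<in> carrier V \<Longrightarrow> v \<in> carrier V \<Longrightarrow> h (u \<oplus>\<^bsub>V\<^esub> v) = h u \<oplus>\<^bsub>W\<^esub> h v"
    "\<And>a v. a \<in> carrier (Fp p) \<Longrightarrow> v \<in> carrier V \<Longrightarrow> h (a \<odot>\<^bsub>V\<^esub> v) = a \<odot>\<^bsub>W\<^esub> h v"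
proof -
  interpret module "Fp p" V using assms unfolding fin_dim_space_def by simp
  obtain h :: "_ \<Rightarrow> nat" where h: "inj_on h (carrier V)"
    using finite_imp_inj_to_nat_seg[OF fin_dim_space_finite[OF assms]] by metis
  define g where "g = the_inv_into (carrier V) h"
  have g: "\<And>v. v \<in> carrier V \<Longrightarrow> g (h v) = v" unfolding g_def using h by (rule the_inv_into_f_f)
  define W :: "(int, nat) module" where
    "W = \<lparr>carrier = h ` carrier V, monoid.mult = undefined, one = undefined, zero = h \<zero>\<^bsub>V\<^esub>,
          add = (\<lambda>u v. h (g u \<oplus>\<^bsub>V\<^esub> g v)), smult = (\<lambda>a v. h (a \<odot>\<^bsub>V\<^esub> g v))\<rparr>"
  have W: "carrier W = h ` carrier V" "\<zero>\<^bsub>W\<^esub> = h \<zero>\<^bsub>V\<^esub>"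
    "\<And>u v. u \<oplus>\<^bsub>W\<^esub> v = h (g u \<oplus>\<^bsub>V\<^esub> g v)" "\<And>a v. a \<odot>\<^bsub>W\<^esub> v = h (a \<odot>\<^bsub>V\<^esub> g v)"
    by (simp_all add: W_def)
  have "abelian_group W"
  proof (rule abelian_groupI)
    fix x assume "x \<in> carrier W"
    then obtain u where "u \<in> carrier V" "x = h u" by (auto simp: W)
    then show "\<exists>y\<in>carrier W. y \<oplus>\<^bsub>W\<^esub> x = \<zero>\<^bsub>W\<^esub>"
      by (intro bexI[of _ "h (\<ominus>\<^bsub>V\<^esub> u)"]) (auto simp: W g M.l_neg)
  qed (auto simp: W g M.a_ac)
  then have "module (Fp p) W"
    using R.is_cring
    by (intro moduleI) (auto simp: W g smult_l_distr smult_r_distr smult_assoc1)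
  then have "fin_dim_space p W"
    using fin_dim_space_finite[OF assms] by (intro finite_module_fin_dim_space) (auto simp: W)
  moreover have "bij_betw h (carrier V) (carrier W)" using h by (auto simp: bij_betw_def W)
  ultimately show thesis by (rule that) (auto simp: W g)
qed

section \<open>Bias of multilinear forms\<close>

lemma multilinear_form_additive_form:
  assumes "multilinear_form p J W \<psi>" "w \<in> prod_space J W" "i \<in> J"
  shows "additive_form p (W i) (\<lambda>v. \<psi> (w(i := v)))"
proof -
  have "w(i := v) \<in> prod_space J W" if "v \<in> carrier (W i)" for v
    using assms(2,3) that by (auto simp: PiE_iff extensional_def)
  with assms show ?thesis
    unfolding multilinear_form_def additive_form_def
    by (auto simp: residue_ring_def Pi_iff)
qed

context
  fixes p :: nat and J :: "nat set" and W :: "nat \<Rightarrow> (int, 'a) module"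
  assumes p: "p > 0" and J: "finite J" and W: "\<And>i. i \<in> J \<Longrightarrow> fin_dim_space p (W i)"
begin

lemma finite_prod_space: "finite (prod_space J W)"
  using J W fin_dim_space_finite by (auto intro: finite_PiE)

lemma card_carrier_pos: "i \<in> J \<Longrightarrow> card (carrier (W i)) > 0"
  using fin_dim_space_finite[OF W] abelian_group.axioms(1)[OF fin_dim_space_abelian_group[OF W]]
  by (metis abelian_monoid.zero_closed card_gt_0_iff empty_iff)

text \<open>Summing over coordinate \<open>i\<close> first, orthogonality leaves the full size of
  that space where the form vanishes identically in this coordinate, and 0 elsewhere.\<close>

lemma sum_chi_multilinear_form:
  assumes \<psi>: "multilinear_form p J W \<psi>" and i: "i \<in> J"
  shows "(\<Sum>w\<in>prod_space J W. chi p (\<psi> w)) =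
    of_nat (card {w \<in> prod_space J W. \<forall>v\<in>carrier (W i). \<psi> (w(i := v)) = 0})"
proof -
  let ?P = "prod_space J W" and ?n = "card (carrier (W i))"
  have "of_nat ?n * (\<Sum>w\<in>?P. chi p (\<psi> w)) = (\<Sum>w\<in>?P. \<Sum>u\<in>carrier (W i). chi p (\<psi> (w(i := u))))"
    by (rule sum_PiE_fun_upd[OF i, symmetric])
  also have "\<dots> = (\<Sum>w\<in>?P. if \<forall>v\<in>carrier (W i). \<psi> (w(i := v)) = 0 then of_nat ?n else 0)"
    using W[OF i] multilinear_form_additive_form[OF \<psi> _ i]
    by (intro sum.cong refl sum_chi_additive_form p fin_dim_space_abelian_group fin_dim_space_finite)
  also have "\<dots> = of_nat ?n * of_nat (card {w \<in> ?P. \<forall>v\<in>carrier (W i). \<psi> (w(i := v)) = 0})"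
    using finite_prod_space by (simp add: sum.If_cases Int_def)
  finally show ?thesis using card_carrier_pos[OF i] by simp
qed

lemma bias_eq_proportion:
  assumes "multilinear_form p J W \<psi>" "i \<in> J"
  shows "bias p J W \<psi> =
    of_real (card {w \<in> prod_space J W. \<forall>v\<in>carrier (W i). \<psi> (w(i := v)) = 0} /
      card (prod_space J W))"
  using sum_chi_multilinear_form[OF assms] J by (simp add: bias_def card_PiE)

text \<open>With \<open>n\<close> the size of the space, the left side is a product of two character
  sums: it is \<open>n^2\<close> if both \<open>A\<close> and \<open>B\<close> vanish identically,
  and 0 otherwise. The right side is \<open>n\<close> times the character sum of
  \<open>A + B\<close>, hence never negative, and also \<open>n^2\<close> in the first case.\<close>

lemma Re_chi_additive_forms_le:
  assumes "i \<in> J" "additive_form p (W i) A" "additive_form p (W i) B"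
  shows "Re (\<Sum>u\<in>carrier (W i). \<Sum>v\<in>carrier (W i). chi p (A u) * chi p (B v)) \<le>
    Re (\<Sum>u\<in>carrier (W i). \<Sum>v\<in>carrier (W i). chi p (A u) * chi p (B u))"
proof -
  note sum_chi = sum_chi_additive_form[OF p fin_dim_space_abelian_group[OF W] fin_dim_space_finite[OF W]]
  let ?C = "carrier (W i)"
  have "(\<Sum>u\<in>?C. \<Sum>v\<in>?C. chi p (A u) * chi p (B v)) = (\<Sum>u\<in>?C. chi p (A u)) * (\<Sum>v\<in>?C. chi p (B v))"
    by (simp add: sum_product)
  moreover have "(\<Sum>u\<in>?C. \<Sum>v\<in>?C. chi p (A u) * chi p (B u)) =
      of_nat (card ?C) * (\<Sum>u\<in>?C. chi p ((A u + B u) mod int p))"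
    by (simp add: sum_distrib_left chi_mod[OF p] chi_add)
  ultimately show ?thesis
    using assms by (simp add: sum_chi additive_form_add[OF p])
qed

text \<open>
  The product of the two biases is an average over pairs \<open>(x, y)\<close> of points. Replacing the
  coordinates of \<open>y\<close> by those of \<open>x\<close> one at a time does not decrease it.
\<close>

lemma bias_add_ge:
  assumes \<phi>: "multilinear_form p J W \<phi>" and \<psi>: "multilinear_form p J W \<psi>"
    and \<theta>: "multilinear_form p J W \<theta>" and i: "i \<in> J"
    and add: "\<And>w. w \<in> prod_space J W \<Longrightarrow> \<theta> w = (\<phi> w + \<psi> w) mod int p"
  shows "Re (bias p J W \<phi>) * Re (bias p J W \<psi>) \<le> Re (bias p J W \<theta>)"
proof -
  let ?P = "prod_space J W"
  \<comment> \<open>The second form reads the coordinates in \<open>S\<close> from \<open>y\<close>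
    and the others from \<open>x\<close>. So \<open>H J\<close> is the product of the two character
    sums, while in \<open>H {}\<close> both forms are evaluated at \<open>x\<close> and combine to
    \<open>\<theta>\<close>.\<close>
  define H where "H S = (\<Sum>x\<in>?P. \<Sum>y\<in>?P. chi p (\<phi> x) * chi p (\<psi> (override_on x y S)))" for S
  have step: "Re (H (insert t S)) \<le> Re (H S)" if t: "t \<in> J" "t \<notin> S" for t S
  proof -
    let ?C = "carrier (W t)"
    \<comment> \<open>Coordinate \<open>t\<close> is resampled independently in \<open>x\<close> (as
      \<open>u\<close>) and in \<open>y\<close> (as \<open>v\<close>); each resampling contributes
      one factor \<open>card ?C\<close>.\<close>
    have average: "of_nat (card ?C) * (of_nat (card ?C) * H T) =
        (\<Sum>x\<in>?P. \<Sum>y\<in>?P. \<Sum>u\<in>?C. \<Sum>v\<in>?C.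
          chi p (\<phi> (x(t := u))) * chi p (\<psi> (override_on (x(t := u)) (y(t := v)) T)))" for T
    proof -
      have "of_nat (card ?C) * (of_nat (card ?C) * H T) = of_nat (card ?C) *
          (\<Sum>x\<in>?P. \<Sum>u\<in>?C. \<Sum>y\<in>?P. chi p (\<phi> (x(t := u))) * chi p (\<psi> (override_on (x(t := u)) y T)))"
        unfolding H_def by (subst sum_PiE_fun_upd[OF t(1)]) (rule refl)
      also have "\<dots> = (\<Sum>x\<in>?P. \<Sum>u\<in>?C. of_nat (card ?C) *
          (\<Sum>y\<in>?P. chi p (\<phi> (x(t := u))) * chi p (\<psi> (override_on (x(t := u)) y T))))"
        by (simp only: sum_distrib_left)
      also have "\<dots> = (\<Sum>x\<in>?P. \<Sum>u\<in>?C. \<Sum>y\<in>?P. \<Sum>v\<in>?C.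
          chi p (\<phi> (x(t := u))) * chi p (\<psi> (override_on (x(t := u)) (y(t := v)) T)))"
        by (subst sum_PiE_fun_upd[OF t(1)]) (rule refl)
      finally show ?thesis by (subst (asm) sum.swap)
    qed
    \<comment> \<open>As \<open>t \<notin> S\<close>, the second form sees \<open>u\<close> in
      coordinate \<open>t\<close> for \<open>S\<close> and \<open>v\<close> for
      \<open>insert t S\<close>. For fixed \<open>x\<close> and \<open>y\<close> these are the two
      sides of \<open>Re_chi_additive_forms_le\<close>.\<close>
    have upd: "override_on (x(t := u)) (y(t := v)) S = (override_on x y S)(t := u)"
      "override_on (x(t := u)) (y(t := v)) (insert t S) = (override_on x y S)(t := v)" for x y u v
      using t(2) by (auto simp: override_on_def fun_eq_iff)
    have "override_on x y S \<in> ?P" if "x \<in> ?P" "y \<in> ?P" for x y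
      using that by (auto simp: override_on_def PiE_iff extensional_def)
    then have "Re (of_nat (card ?C) * (of_nat (card ?C) * H (insert t S))) \<le>
        Re (of_nat (card ?C) * (of_nat (card ?C) * H S))"
      unfolding average upd Re_sum[of _ ?P]
      by (intro sum_mono Re_chi_additive_forms_le t(1) multilinear_form_additive_form[OF \<phi>]
          multilinear_form_additive_form[OF \<psi>])
    then show ?thesis using card_carrier_pos[OF t(1)] by simp
  qed
  have "S \<subseteq> J \<Longrightarrow> Re (H S) \<le> Re (H {})" if "finite S" for S
    using that
  proof (induction S)
    case (insert t S)
    then show ?case using step[of t S] by auto
  qed simp
  from this[OF J subset_refl] have le: "Re (H J) \<le> Re (H {})" .
  have "override_on x y J = y" if "x \<in> ?P" "y \<in> ?P" for x y
    using that by (auto simp: override_on_def PiE_iff extensional_def fun_eq_iff)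
  then have "H J = (\<Sum>x\<in>?P. chi p (\<phi> x)) * (\<Sum>y\<in>?P. chi p (\<psi> y))"
    by (simp add: H_def sum_product)
  moreover have "H {} = of_nat (card ?P) * (\<Sum>x\<in>?P. chi p (\<theta> x))"
    by (simp add: H_def sum_distrib_left add chi_mod[OF p] chi_add)
  moreover have "card ?P > 0" using card_carrier_pos J by (simp add: card_PiE prod_pos)
  ultimately show ?thesis
    using le by (simp add: bias_eq_proportion[OF _ i] sum_chi_multilinear_form[OF _ i] \<phi> \<psi> \<theta>
      field_simps power2_eq_square flip: of_nat_mult)
qed

end

section \<open>Fibres of varieties and propagation of bad points\<close>

text \<open>The vector of all values \<open>A j v\<close> takes at most \<open>p ^ d\<close> values.
  Subtracting a fixed member of a nonempty level set maps that set injectively into the common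
  kernel.\<close>

lemma card_common_kernel_ge:
  assumes "p > 0" "abelian_group V" "finite (carrier V)"
    and A: "\<And>j. j < d \<Longrightarrow> additive_form p V (A j)"
  shows "card (carrier V) \<le> p ^ d * card {v \<in> carrier V. \<forall>j<d. A j v = 0}"
proof -
  interpret abelian_group V by fact
  let ?K = "{v \<in> carrier V. \<forall>j<d. A j v = 0}"
  define T where "T v = (\<lambda>j\<in>{..<d}. A j v)" for v
  let ?D = "{..<d} \<rightarrow>\<^sub>E {0..<int p}"
  have "T v \<in> ?D" if "v \<in> carrier V" for v
    using A that unfolding T_def additive_form_def by (auto simp: Pi_iff)
  then have "carrier V = (\<Union>t\<in>?D. {v \<in> carrier V. T v = t})" by auto
  then have "card (carrier V) \<le> (\<Sum>t\<in>?D. card {v \<in> carrier V. T v = t})"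
    using card_UN_le[of ?D "\<lambda>t. {v \<in> carrier V. T v = t}"] by (simp add: finite_PiE)
  also have "\<dots> \<le> (\<Sum>t\<in>?D. card ?K)"
  proof (rule sum_mono)
    fix t
    show "card {v \<in> carrier V. T v = t} \<le> card ?K"
    proof (cases "{v \<in> carrier V. T v = t} = {}")
      case False
      then obtain u where u: "u \<in> carrier V" "T u = t" by auto
      have "A j (v \<ominus>\<^bsub>V\<^esub> u) = 0" if "v \<in> carrier V" "T v = t" "j < d" for v j
      proof -
        have "T v j = T u j" using that u by simp
        then have "A j v = A j u" using that(3) by (simp add: T_def)
        then show ?thesis using additive_form_minus[OF assms(2) A[OF that(3)] that(1) u(1)] by simp
      qed
      moreover have "inj_on (\<lambda>v. v \<ominus>\<^bsub>V\<^esub> u) {v \<in> carrier V. T v = t}"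
        using u(1) by (intro inj_onI) (auto simp: minus_eq)
      ultimately show ?thesis
        using u(1) assms(3) by (intro card_inj_on_le[of "\<lambda>v. v \<ominus>\<^bsub>V\<^esub> u"]) auto
    qed (simp only: card.empty le0)
  qed
  also have "\<dots> = p ^ d * card ?K" by (simp add: card_PiE)
  finally show ?thesis .
qed

lemma variety_by_subset: "variety_by p k U d Z \<Longrightarrow> Z \<subseteq> prod_space {1..k} U"
  unfolding variety_by_def by auto

text \<open>Through a point of \<open>Y\<close>, the line of points differing only in coordinate
  \<open>i\<close> meets \<open>Y\<close> in a common kernel of \<open>d\<close> additive forms, so
  \<open>card_common_kernel_ge\<close> bounds its size from below.\<close>

lemma variety_by_fibre:
  assumes Y: "variety_by p k U d Y" and x: "x \<in> Y" and i: "i \<in> {1..k}" and "p > 0"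
  obtains A where "\<And>j. j < d \<Longrightarrow> additive_form p (U i) (A j)"
    "\<And>u. u \<in> carrier (U i) \<Longrightarrow> x(i := u) \<in> Y \<longleftrightarrow> (\<forall>j<d. A j u = 0)"
proof -
  from Y obtain I \<beta> where
    \<beta>: "\<And>j. j < d \<Longrightarrow> I j \<noteq> {} \<and> I j \<subseteq> {1..k} \<and> multilinear_form p (I j) U (\<beta> j)"
    and Y_eq: "Y = {x \<in> prod_space {1..k} U. \<forall>j<d. \<beta> j (restrict x (I j)) = \<zero>\<^bsub>Fp p\<^esub>}"
    unfolding variety_by_def by blast
  \<comment> \<open>A form without coordinate \<open>i\<close> is constant along the fibre, and its
    value is 0 because \<open>x \<in> Y\<close>; the zero form therefore represents it.\<close>
  define A where "A j u = (if i \<in> I j then \<beta> j ((restrict x (I j))(i := u)) else 0)" for j u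
  from x have xP: "x \<in> prod_space {1..k} U" using variety_by_subset[OF Y] by auto
  show thesis
  proof
    fix j assume j: "j < d"
    have "restrict x (I j) \<in> prod_space (I j) U"
      using xP \<beta>[OF j] by (auto simp: PiE_iff)
    then show "additive_form p (U i) (A j)"
      using \<beta>[OF j] multilinear_form_additive_form[of p "I j" U "\<beta> j" "restrict x (I j)" i] \<open>p > 0\<close>
      by (cases "i \<in> I j") (auto simp: A_def[abs_def] additive_form_def)
  next
    fix u assume u: "u \<in> carrier (U i)"
    have "x(i := u) \<in> prod_space {1..k} U"
      using xP i u by (auto simp: PiE_iff extensional_def)
    moreover have "\<beta> j (restrict (x(i := u)) (I j)) = \<zero>\<^bsub>Fp p\<^esub> \<longleftrightarrow> A j u = 0" if "j < d" for j
    proof (cases "i \<in> I j")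
      case True
      then have "restrict (x(i := u)) (I j) = (restrict x (I j))(i := u)" by auto
      then show ?thesis using True by (simp add: A_def residue_ring_def)
    next
      case False
      then have "restrict (x(i := u)) (I j) = restrict x (I j)" by auto
      then show ?thesis using False x that by (simp add: A_def Y_eq)
    qed
    ultimately show "x(i := u) \<in> Y \<longleftrightarrow> (\<forall>j<d. A j u = 0)" by (simp add: Y_eq)
  qed
qed

text \<open>
  If \<open>f x\<close> is below \<open>e\<^bsup>2^Suc i\<^esup>\<close>, then for each \<open>u\<close> in the fibre of \<open>Y\<close> through \<open>x\<close> in
  direction \<open>Suc i\<close>, replacing this coordinate by \<open>u\<close> or by its difference with \<open>u\<close> makes the
  value of \<open>f\<close> smaller than \<open>e\<^bsup>2^i\<^esup>\<close>. So half of the fibre is bad at level \<open>i\<close>.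
\<close>

lemma supermultiplicative_bad_points:
  fixes f :: "(nat \<Rightarrow> 'a) \<Rightarrow> real"
  assumes p: "p > 0" and U: "\<And>i. i \<in> {1..k} \<Longrightarrow> fin_dim_space p (U i)"
    and Y: "variety_by p k U d Y"
    and f: "\<And>x i u v. x \<in> prod_space {1..k} U \<Longrightarrow> i \<in> {1..k} \<Longrightarrow> u \<in> carrier (U i) \<Longrightarrow>
      v \<in> carrier (U i) \<Longrightarrow> f (x(i := u)) * f (x(i := v)) \<le> f (x(i := u \<oplus>\<^bsub>U i\<^esub> v))"
    and e: "e > 0"
  shows "i \<le> k \<Longrightarrow> x \<in> Y \<Longrightarrow> f x < e ^ (2 ^ i) \<Longrightarrow>
    (\<Prod>j\<in>{1..i}. card (carrier (U j))) \<le>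
      (2 * p ^ d) ^ i * card {y \<in> Y. f y < e \<and> (\<forall>j. j \<notin> {1..i} \<longrightarrow> y j = x j)}"
proof (induction i arbitrary: x)
  \<comment> \<open>No coordinate is free, so \<open>x\<close> itself is the only point
    counted.\<close>
  case 0
  then have "{y \<in> Y. f y < e \<and> (\<forall>j. j \<notin> {1..0} \<longrightarrow> y j = x j)} = {x}"
    by auto
  then show ?case by simp
next
  have Y_P: "Y \<subseteq> prod_space {1..k} U" by (rule variety_by_subset[OF Y])
  have fin: "finite Y"
    using Y_P finite_prod_space[OF p finite_atLeastAtMost U] by (rule finite_subset)
  case (Suc i)
  let ?i = "Suc i"
  from Suc.prems have i: "?i \<in> {1..k}" by auto
  from Suc.prems Y_P have xP: "x \<in> prod_space {1..k} U" by auto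
  then have xi: "x ?i \<in> carrier (U ?i)" using i by auto
  interpret abelian_group "U ?i" using fin_dim_space_abelian_group[OF U[OF i]] .
  note finU = fin_dim_space_finite[OF U[OF i]]
  from variety_by_fibre[OF Y Suc.prems(2) i p] obtain A where
    A: "\<And>j. j < d \<Longrightarrow> additive_form p (U ?i) (A j)"
    and A_Y: "\<And>u. u \<in> carrier (U ?i) \<Longrightarrow> x(?i := u) \<in> Y \<longleftrightarrow> (\<forall>j<d. A j u = 0)" by blast
  \<comment> \<open>\<open>G\<close> is the fibre of \<open>Y\<close> through \<open>x\<close> in
    direction \<open>Suc i\<close>, and \<open>B\<close> is its part that is bad at level
    \<open>i\<close>, to which the induction hypothesis applies.\<close>
  define G where "G = {u \<in> carrier (U ?i). \<forall>j<d. A j u = 0}"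
  define B where "B = {u \<in> G. f (x(?i := u)) < e ^ (2 ^ i)}"
  define T where "T n z = {y \<in> Y. f y < e \<and> (\<forall>j. j \<notin> {1..n} \<longrightarrow> y j = z j)}" for n z
  have finG: "finite G" "finite B" unfolding B_def G_def using finU by auto
  have x_ker: "A j (x ?i) = 0" if "j < d" for j
    using A_Y[OF xi] Suc.prems(2) that by simp
  have diff: "x ?i \<ominus>\<^bsub>U ?i\<^esub> u \<in> G" if "u \<in> G" for u
    using that xi x_ker additive_form_minus[OF fin_dim_space_abelian_group[OF U[OF i]] A]
    unfolding G_def by auto
  have "G \<subseteq> B \<union> (\<lambda>u. x ?i \<ominus>\<^bsub>U ?i\<^esub> u) ` B"
  proof
    fix u assume u: "u \<in> G"
    let ?v = "x ?i \<ominus>\<^bsub>U ?i\<^esub> u"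
    have uv: "u \<in> carrier (U ?i)" "?v \<in> carrier (U ?i)" using u diff[OF u] by (auto simp: G_def)
    have eqs: "u \<oplus>\<^bsub>U ?i\<^esub> ?v = x ?i" "x ?i \<ominus>\<^bsub>U ?i\<^esub> ?v = u"
      using uv(1) xi a_lcomm[of u "x ?i" "\<ominus>\<^bsub>U ?i\<^esub> u"]
      by (simp_all add: minus_eq minus_add r_neg r_neg2 flip: a_assoc)
    then have "f (x(?i := u)) * f (x(?i := ?v)) < e ^ (2 ^ ?i)"
      using f[OF xP i uv] Suc.prems(3) by simp
    moreover have "e ^ (2 ^ ?i) = e ^ (2 ^ i) * e ^ (2 ^ i)" by (simp add: mult_2 power_add)
    moreover have "e ^ (2 ^ i) * e ^ (2 ^ i) \<le> f (x(?i := u)) * f (x(?i := ?v))"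
      if "e ^ (2 ^ i) \<le> f (x(?i := u))" "e ^ (2 ^ i) \<le> f (x(?i := ?v))"
      using that e by (intro mult_mono') auto
    ultimately have "f (x(?i := u)) < e ^ (2 ^ i) \<or> f (x(?i := ?v)) < e ^ (2 ^ i)"
      by linarith
    then show "u \<in> B \<union> (\<lambda>u. x ?i \<ominus>\<^bsub>U ?i\<^esub> u) ` B"
    proof
      assume "f (x(?i := ?v)) < e ^ (2 ^ i)"
      then have "?v \<in> B" using diff[OF u] by (simp add: B_def)
      then show ?thesis using eqs(2) by (intro UnI2) (metis image_eqI)
    qed (use u B_def in auto)
  qed
  then have "card G \<le> card (B \<union> (\<lambda>u. x ?i \<ominus>\<^bsub>U ?i\<^esub> u) ` B)"
    using finG by (intro card_mono) auto
  also have "\<dots> \<le> 2 * card B"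
    using card_Un_le[of B "(\<lambda>u. x ?i \<ominus>\<^bsub>U ?i\<^esub> u) ` B"] card_image_le[OF finG(2), of "\<lambda>u. x ?i \<ominus>\<^bsub>U ?i\<^esub> u"]
    by simp
  finally have G_le: "card G \<le> 2 * card B" .
  have "card (carrier (U ?i)) \<le> p ^ d * card G"
    unfolding G_def
    by (rule card_common_kernel_ge[OF p fin_dim_space_abelian_group[OF U[OF i]] finU A])
  also have "\<dots> \<le> 2 * p ^ d * card B" using G_le by simp
  finally have U_le: "card (carrier (U ?i)) \<le> 2 * p ^ d * card B" .
  have IH: "(\<Prod>j\<in>{1..i}. card (carrier (U j))) \<le> (2 * p ^ d) ^ i * card (T i (x(?i := u)))"
    if "u \<in> B" for u
  proof -
    have "i \<le> k" "x(?i := u) \<in> Y" "f (x(?i := u)) < e ^ (2 ^ i)"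
      using that Suc.prems(1) A_Y by (auto simp: B_def G_def)
    then show ?thesis unfolding T_def by (rule Suc.IH)
  qed
  have "(\<Union>u\<in>B. T i (x(?i := u))) \<subseteq> T ?i x"
    by (auto simp: T_def)
  then have "card (\<Union>u\<in>B. T i (x(?i := u))) \<le> card (T ?i x)"
    using fin by (intro card_mono) (auto simp: T_def)
  \<comment> \<open>Points of \<open>T i (x(?i := u))\<close> have coordinate \<open>?i\<close>
    equal to \<open>u\<close>, because only coordinates up to \<open>i\<close> are free. Distinct
    \<open>u\<close> thus yield disjoint sets and their sizes add up.\<close>
  moreover have "card (\<Union>u\<in>B. T i (x(?i := u))) = (\<Sum>u\<in>B. card (T i (x(?i := u))))"
  proof (intro card_UN_disjoint finG ballI impI)
    fix u v :: 'a assume "u \<noteq> v"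
    have "y ?i = w" if "y \<in> T i (x(?i := w))" for y w
      using that by (auto simp: T_def dest!: spec[of _ ?i])
    with \<open>u \<noteq> v\<close> show "T i (x(?i := u)) \<inter> T i (x(?i := v)) = {}" by blast
  qed (use fin in \<open>auto simp: T_def\<close>)
  ultimately have T_le: "(\<Sum>u\<in>B. card (T i (x(?i := u)))) \<le> card (T ?i x)" by simp
  have "(\<Prod>j\<in>{1..?i}. card (carrier (U j))) =
      card (carrier (U ?i)) * (\<Prod>j\<in>{1..i}. card (carrier (U j)))"
    by (simp add: atLeastAtMostSuc_conv)
  also have "\<dots> \<le> 2 * p ^ d * card B * (\<Prod>j\<in>{1..i}. card (carrier (U j)))"
    using U_le by (rule mult_right_mono) simp
  also have "\<dots> = 2 * p ^ d * (\<Sum>u\<in>B. \<Prod>j\<in>{1..i}. card (carrier (U j)))" by simp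
  also have "\<dots> \<le> 2 * p ^ d * (\<Sum>u\<in>B. (2 * p ^ d) ^ i * card (T i (x(?i := u))))"
    by (intro mult_left_mono sum_mono IH) auto
  also have "\<dots> = (2 * p ^ d) ^ ?i * (\<Sum>u\<in>B. card (T i (x(?i := u))))"
    by (simp add: sum_distrib_left mult.assoc)
  also have "\<dots> \<le> (2 * p ^ d) ^ ?i * card (T ?i x)"
    using T_le by (rule mult_left_mono) simp
  finally show ?case unfolding T_def .
qed

section \<open>Transport of varieties along linear bijections\<close>

definition linear_on :: "nat \<Rightarrow> (int, 'a) module \<Rightarrow> (int, 'b) module \<Rightarrow> ('a \<Rightarrow> 'b) \<Rightarrow> bool" where
  "linear_on p V W h \<longleftrightarrow> h \<in> carrier V \<rightarrow> carrier W \<and>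
     (\<forall>u\<in>carrier V. \<forall>v\<in>carrier V. h (u \<oplus>\<^bsub>V\<^esub> v) = h u \<oplus>\<^bsub>W\<^esub> h v) \<and>
     (\<forall>a\<in>carrier (Fp p). \<forall>v\<in>carrier V. h (a \<odot>\<^bsub>V\<^esub> v) = a \<odot>\<^bsub>W\<^esub> h v)"

lemma linear_on_inv_into:
  assumes "fin_dim_space p V" "linear_on p V W h" "bij_betw h (carrier V) (carrier W)"
  shows "linear_on p W V (inv_into (carrier V) h)"
proof -
  interpret module "Fp p" V using assms(1) unfolding fin_dim_space_def by simp
  let ?g = "inv_into (carrier V) h"
  have g: "?g w \<in> carrier V" "h (?g w) = w" if "w \<in> carrier W" for w
    using assms(3) that
    by (auto simp: bij_betw_def intro: inv_into_into f_inv_into_f)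
  have gh: "?g (h v) = v" if "v \<in> carrier V" for v
    using assms(3) that by (simp add: bij_betw_def)
  have "?g (u \<oplus>\<^bsub>W\<^esub> v) = ?g u \<oplus>\<^bsub>V\<^esub> ?g v" if "u \<in> carrier W" "v \<in> carrier W" for u v
    using gh[of "?g u \<oplus>\<^bsub>V\<^esub> ?g v"] g that assms(2) by (simp add: linear_on_def)
  moreover have "?g (a \<odot>\<^bsub>W\<^esub> v) = a \<odot>\<^bsub>V\<^esub> ?g v" if "a \<in> carrier (Fp p)" "v \<in> carrier W" for a v
    using gh[of "a \<odot>\<^bsub>V\<^esub> ?g v"] g that assms(2) by (simp add: linear_on_def)
  ultimately show ?thesis using g by (simp add: linear_on_def)
qed

lemma multilinear_form_pullback:
  assumes \<beta>: "multilinear_form p J U \<beta>" and g: "\<And>i. i \<in> J \<Longrightarrow> linear_on p (W i) (U i) (g i)"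
  shows "multilinear_form p J W (\<lambda>y. \<beta> (\<lambda>i\<in>J. g i (y i)))"
proof -
  have P: "(\<lambda>i\<in>J. g i (y i)) \<in> prod_space J U" if "y \<in> prod_space J W" for y
    using that g by (auto simp: linear_on_def PiE_iff Pi_iff)
  have upd: "(\<lambda>i\<in>J. g i ((y(j := v)) i)) = (\<lambda>i\<in>J. g i (y i))(j := g j v)" if "j \<in> J" for y j v
    using that by auto
  show ?thesis
    unfolding multilinear_form_def
  proof (intro conjI ballI)
    show "(\<lambda>y. \<beta> (\<lambda>i\<in>J. g i (y i))) \<in> prod_space J W \<rightarrow> carrier (Fp p)"
      using P \<beta> unfolding multilinear_form_def by blast
  next
    fix w i u v assume "w \<in> prod_space J W" "i \<in> J" "u \<in> carrier (W i)" "v \<in> carrier (W i)"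
    then show "\<beta> (\<lambda>j\<in>J. g j ((w(i := u \<oplus>\<^bsub>W i\<^esub> v)) j)) =
        \<beta> (\<lambda>j\<in>J. g j ((w(i := u)) j)) \<oplus>\<^bsub>Fp p\<^esub> \<beta> (\<lambda>j\<in>J. g j ((w(i := v)) j))"
      using P \<beta> g[of i] unfolding upd[OF \<open>i \<in> J\<close>] multilinear_form_def linear_on_def
      by (auto simp: Pi_iff)
  next
    fix w i a v assume "w \<in> prod_space J W" "i \<in> J" "a \<in> carrier (Fp p)" "v \<in> carrier (W i)"
    then show "\<beta> (\<lambda>j\<in>J. g j ((w(i := a \<odot>\<^bsub>W i\<^esub> v)) j)) =
        a \<otimes>\<^bsub>Fp p\<^esub> \<beta> (\<lambda>j\<in>J. g j ((w(i := v)) j))"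
      using P \<beta> g[of i] unfolding upd[OF \<open>i \<in> J\<close>] multilinear_form_def linear_on_def
      by (auto simp: Pi_iff)
  qed
qed

text \<open>Each defining form is pulled back separately, with the same index set, so the number
  \<open>d\<close> of forms is preserved.\<close>

lemma variety_by_preimage:
  assumes Z: "variety_by p k U d Z" and g: "\<And>i. i \<in> {1..k} \<Longrightarrow> linear_on p (W i) (U i) (g i)"
  shows "variety_by p k W d {y \<in> prod_space {1..k} W. (\<lambda>i\<in>{1..k}. g i (y i)) \<in> Z}"
proof -
  from Z obtain I \<beta> where
    \<beta>: "\<And>j. j < d \<Longrightarrow> I j \<noteq> {} \<and> I j \<subseteq> {1..k} \<and> multilinear_form p (I j) U (\<beta> j)"
    and Z_eq: "Z = {x \<in> prod_space {1..k} U. \<forall>j<d. \<beta> j (restrict x (I j)) = \<zero>\<^bsub>Fp p\<^esub>}"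
    unfolding variety_by_def by blast
  define \<gamma> where "\<gamma> j y = \<beta> j (\<lambda>i\<in>I j. g i (y i))" for j y
  have "I j \<noteq> {} \<and> I j \<subseteq> {1..k} \<and> multilinear_form p (I j) W (\<gamma> j)" if "j < d" for j
  proof -
    have "multilinear_form p (I j) W (\<gamma> j)"
      unfolding \<gamma>_def[abs_def] using \<beta>[OF that] g by (intro multilinear_form_pullback) auto
    then show ?thesis using \<beta>[OF that] by simp
  qed
  moreover
  have "(\<lambda>i\<in>{1..k}. g i (y i)) \<in> Z \<longleftrightarrow> (\<forall>j<d. \<gamma> j (restrict y (I j)) = \<zero>\<^bsub>Fp p\<^esub>)"
    if y: "y \<in> prod_space {1..k} W" for y
  proof -
    have "(\<lambda>i\<in>{1..k}. g i (y i)) \<in> prod_space {1..k} U"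
      using y g by (auto simp: linear_on_def PiE_iff Pi_iff)
    moreover have "restrict (\<lambda>i\<in>{1..k}. g i (y i)) (I j) = (\<lambda>i\<in>I j. g i (restrict y (I j) i))"
      if "j < d" for j
      using \<beta>[OF that] by (auto simp: restrict_def fun_eq_iff)
    ultimately show ?thesis by (simp add: Z_eq \<gamma>_def del: restrict_apply)
  qed
  then have "{y \<in> prod_space {1..k} W. (\<lambda>i\<in>{1..k}. g i (y i)) \<in> Z} =
      {y \<in> prod_space {1..k} W. \<forall>j<d. \<gamma> j (restrict y (I j)) = \<zero>\<^bsub>Fp p\<^esub>}"
    by (intro Collect_cong conj_cong refl)
  ultimately show ?thesis
    unfolding variety_by_def by (intro exI[of _ I] exI[of _ \<gamma>]) simp
qed

text \<open>Frees the defining property of \<open>K\<close> from the type \<open>nat\<close>: move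
  \<open>Z\<close> to a copy of the spaces on natural numbers, find the subvariety there and pull it
  back.\<close>

lemma variety_constantD:
  fixes U :: "nat \<Rightarrow> (int, 'a) module"
  assumes K: "variety_constant k K" and p: "prime p"
    and U: "\<And>i. i \<in> {1..k} \<Longrightarrow> fin_dim_space p (U i)"
    and Z: "multilinear_variety p k U Z"
  obtains Y d where "Y \<subseteq> Z" "variety_by p k U d Y"
    "real d \<le> real K * (log (real p) (1 / density k U Z) + 1)"
proof -
  \<comment> \<open>The copy and its bijection are packed into a pair, so that one choice over
    \<open>i\<close> yields both families.\<close>
  have "\<exists>Wh :: (int, nat) module \<times> ('a \<Rightarrow> nat). fin_dim_space p (fst Wh) \<and>
      bij_betw (snd Wh) (carrier (U i)) (carrier (fst Wh)) \<and> linear_on p (U i) (fst Wh) (snd Wh)"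
    if "i \<in> {1..k}" for i
  proof -
    from fin_dim_space_nat_copy[OF U[OF that]] obtain W :: "(int, nat) module" and h where
      "fin_dim_space p W" "bij_betw h (carrier (U i)) (carrier W)"
      "\<And>u v. u \<in> carrier (U i) \<Longrightarrow> v \<in> carrier (U i) \<Longrightarrow> h (u \<oplus>\<^bsub>U i\<^esub> v) = h u \<oplus>\<^bsub>W\<^esub> h v"
      "\<And>a v. a \<in> carrier (Fp p) \<Longrightarrow> v \<in> carrier (U i) \<Longrightarrow> h (a \<odot>\<^bsub>U i\<^esub> v) = a \<odot>\<^bsub>W\<^esub> h v"
      by metis
    then show ?thesis
      by (intro exI[of _ "(W, h)"]) (auto simp: linear_on_def bij_betw_def)
  qed
  then obtain Wh :: "nat \<Rightarrow> (int, nat) module \<times> ('a \<Rightarrow> nat)" where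
    Wh: "\<forall>i\<in>{1..k}. fin_dim_space p (fst (Wh i)) \<and>
      bij_betw (snd (Wh i)) (carrier (U i)) (carrier (fst (Wh i))) \<and>
      linear_on p (U i) (fst (Wh i)) (snd (Wh i))"
    by metis
  define W where "W i = fst (Wh i)" for i
  define h where "h i = snd (Wh i)" for i
  have W: "\<And>i. i \<in> {1..k} \<Longrightarrow> fin_dim_space p (W i)"
    and h: "\<And>i. i \<in> {1..k} \<Longrightarrow> linear_on p (U i) (W i) (h i)"
    and bij: "\<And>i. i \<in> {1..k} \<Longrightarrow> bij_betw (h i) (carrier (U i)) (carrier (W i))"
    using Wh unfolding W_def h_def by blast+
  define g where "g i = inv_into (carrier (U i)) (h i)" for i
  have g: "linear_on p (W i) (U i) (g i)" if "i \<in> {1..k}" for i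
    unfolding g_def using linear_on_inv_into U h bij that by blast
  have gh: "g i (h i u) = u" if "i \<in> {1..k}" "u \<in> carrier (U i)" for i u
    using bij that by (simp add: g_def bij_betw_def)
  have hg: "h i (g i w) = w" if "i \<in> {1..k}" "w \<in> carrier (W i)" for i w
    using bij[OF that(1)] that(2) by (auto simp: g_def bij_betw_def intro: f_inv_into_f)
  let ?PU = "prod_space {1..k} U" and ?PW = "prod_space {1..k} W"
  define G where "G y = (\<lambda>i\<in>{1..k}. g i (y i))" for y
  define H where "H x = (\<lambda>i\<in>{1..k}. h i (x i))" for x
  have G_in: "G y \<in> ?PU" if "y \<in> ?PW" for y
    using that g by (auto simp: G_def linear_on_def PiE_iff Pi_iff)
  have H_in: "H x \<in> ?PW" if "x \<in> ?PU" for x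
    using that h by (auto simp: H_def linear_on_def PiE_iff Pi_iff)
  have GH: "G (H x) = x" if "x \<in> ?PU" for x
    using that gh by (auto simp: G_def H_def PiE_iff extensional_def fun_eq_iff)
  have HG: "H (G y) = y" if "y \<in> ?PW" for y
    using that hg by (auto simp: G_def H_def PiE_iff extensional_def fun_eq_iff)
  from Z obtain d where d: "variety_by p k U d Z" unfolding multilinear_variety_def by blast
  define Z' where "Z' = {y \<in> ?PW. G y \<in> Z}"
  have "variety_by p k W d Z'"
    unfolding Z'_def G_def using variety_by_preimage[OF d g] .
  then obtain Y' e where Y': "Y' \<subseteq> Z'" "variety_by p k W e Y'"
    "real e \<le> real K * (log (real p) (1 / density k W Z') + 1)"
    using K p W unfolding variety_constant_def multilinear_variety_def variety_of_codim_le_def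
    by blast
  \<comment> \<open>\<open>G\<close> matches both the ambient products and the two varieties, so the
    densities agree and the codimension bound carries over unchanged.\<close>
  have "bij_betw G ?PW ?PU"
    by (rule bij_betw_byWitness[of _ H]) (use G_in H_in GH HG in auto)
  moreover have "bij_betw G Z' Z"
  proof (rule bij_betw_byWitness[of _ H])
    have "H x \<in> Z'" "G (H x) = x" if "x \<in> Z" for x
    proof -
      have "x \<in> ?PU" using variety_by_subset[OF d] that by blast
      with H_in[of x] GH[of x] that show "H x \<in> Z'" "G (H x) = x" by (simp_all add: Z'_def)
    qed
    then show "\<forall>x\<in>Z. G (H x) = x" "H ` Z \<subseteq> Z'" by blast+
  qed (simp_all add: Z'_def HG image_subset_iff)
  ultimately have dens: "density k W Z' = density k U Z"
    unfolding density_def by (simp only: bij_betw_same_card)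
  \<comment> \<open>The set corresponding to \<open>Y'\<close> is written as a preimage under
    \<open>H\<close>, the form to which \<open>variety_by_preimage\<close> applies.\<close>
  have "variety_by p k U e {x \<in> ?PU. H x \<in> Y'}"
    unfolding H_def using variety_by_preimage[OF Y'(2) h] .
  moreover have "{x \<in> ?PU. H x \<in> Y'} \<subseteq> Z"
    using Y'(1) GH by (force simp: Z'_def)
  ultimately show thesis
    using Y'(3) that unfolding dens by blast
qed

section \<open>Choice of a dense slice and the numerical estimate\<close>

text \<open>Both requirements on \<open>z\<close> are obtained at once by averaging a single weight
  \<open>g\<close>, which rewards a large slice and penalises its bad points.\<close>

lemma exists_dense_slice_few_bad:
  fixes R :: "'x \<Rightarrow> 'z \<Rightarrow> bool" and P :: "'x set" and Q :: "'z set" and c e :: real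
  defines "f \<equiv> \<lambda>x. card {z \<in> Q. R x z} / card Q"
  assumes fin: "finite P" "finite Q" "Q \<noteq> {}" and ce: "c > 0" "e > 0"
    and S: "c * card P \<le> card {x \<in> P. c \<le> f x}"
  obtains z where "z \<in> Q" "c\<^sup>2 * card P \<le> 2 * card {x \<in> P. R x z}"
    "c\<^sup>2 * card {x \<in> P. R x z \<and> f x < e} \<le> 2 * e * card P"
proof -
  have M: "real (card Q) > 0" using fin by (simp add: card_gt_0_iff)
  have f_nonneg: "f x \<ge> 0" for x by (simp add: f_def)
  \<comment> \<open>Double counting of the related pairs in \<open>A\<close> and
    \<open>Q\<close>.\<close>
  have swap: "(\<Sum>z\<in>Q. real (card {x \<in> A. R x z})) = card Q * (\<Sum>x\<in>A. f x)" if "finite A" for A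
  proof -
    have "(\<Sum>z\<in>Q. card {x \<in> A. R x z}) = (\<Sum>x\<in>A. card {z \<in> Q. R x z})"
      using fin(2) that by (intro sum_multicount_gen) auto
    then have "(\<Sum>z\<in>Q. real (card {x \<in> A. R x z})) = (\<Sum>x\<in>A. real (card {z \<in> Q. R x z}))"
      by (simp flip: of_nat_sum)
    also have "\<dots> = card Q * (\<Sum>x\<in>A. f x)" using M by (simp add: f_def sum_distrib_left)
    finally show ?thesis .
  qed
  have "c * (c * card P) \<le> c * card {x \<in> P. c \<le> f x}" using S ce by simp
  also have "\<dots> = (\<Sum>x\<in>{x \<in> P. c \<le> f x}. c)" by simp
  also have "\<dots> \<le> (\<Sum>x\<in>{x \<in> P. c \<le> f x}. f x)" by (intro sum_mono) auto
  also have "\<dots> \<le> (\<Sum>x\<in>P. f x)" using fin f_nonneg by (intro sum_mono2) auto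
  finally have total: "c\<^sup>2 * card P \<le> (\<Sum>x\<in>P. f x)" by (simp add: power2_eq_square)
  have "(\<Sum>x\<in>{x \<in> P. f x < e}. f x) \<le> (\<Sum>x\<in>{x \<in> P. f x < e}. e)" by (intro sum_mono) auto
  also have "\<dots> = e * card {x \<in> P. f x < e}" by simp
  also have "\<dots> \<le> e * card P" using fin ce by (intro mult_left_mono) (auto intro: card_mono)
  finally have bad: "(\<Sum>x\<in>{x \<in> P. f x < e}. f x) \<le> e * card P" .
  \<comment> \<open>By \<open>total\<close> and \<open>bad\<close>, the mean of the positive term is
    at least \<open>2 * e * c\<^sup>2 * card P\<close> and that of the penalty at most half of this.
    Hence some \<open>z\<close> has \<open>g z\<close> at least
    \<open>e * c\<^sup>2 * card P\<close>.\<close>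
  define g where "g z = 2 * e * card {x \<in> P. R x z} - c\<^sup>2 * card {x \<in> {x \<in> P. f x < e}. R x z}" for z
  have "(\<Sum>z\<in>Q. g z) = 2 * e * (card Q * (\<Sum>x\<in>P. f x)) - c\<^sup>2 * (card Q * (\<Sum>x\<in>{x \<in> P. f x < e}. f x))"
    using fin by (simp add: g_def sum_subtractf flip: sum_distrib_left swap)
  also have "\<dots> = card Q * (2 * e * (\<Sum>x\<in>P. f x) - c\<^sup>2 * (\<Sum>x\<in>{x \<in> P. f x < e}. f x))"
    by (simp add: algebra_simps)
  also have "\<dots> \<ge> card Q * (2 * e * (c\<^sup>2 * card P) - c\<^sup>2 * (e * card P))"
    using total bad ce by (intro mult_left_mono diff_mono) auto
  finally have "(\<Sum>z\<in>Q. g z) \<ge> (\<Sum>z\<in>Q. e * c\<^sup>2 * card P)" by (simp add: algebra_simps)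
  then obtain z where z: "z \<in> Q" "g z \<ge> e * c\<^sup>2 * card P"
    using fin(2,3) by (metis (mono_tags, lifting) not_le sum_strict_mono)
  \<comment> \<open>Dropping the penalty gives the size of the slice. Below, bounding the slice by
    \<open>P\<close> and dropping the lower bound on \<open>g z\<close> gives the bound on bad
    points.\<close>
  have "e * (c\<^sup>2 * card P) \<le> e * (2 * card {x \<in> P. R x z})"
  proof -
    have "0 \<le> c\<^sup>2 * card {x \<in> {x \<in> P. f x < e}. R x z}" by simp
    then show ?thesis using z(2) unfolding g_def by (simp only: mult.assoc mult.left_commute[of _ e])
  qed
  moreover have "c\<^sup>2 * card {x \<in> P. R x z \<and> f x < e} \<le> 2 * e * card P"
  proof -
    have "{x \<in> {x \<in> P. f x < e}. R x z} = {x \<in> P. R x z \<and> f x < e}" by auto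
    then have "c\<^sup>2 * card {x \<in> P. R x z \<and> f x < e} + e * c\<^sup>2 * card P \<le> 2 * e * card {x \<in> P. R x z}"
      using z(2) unfolding g_def by simp
    moreover have "0 \<le> e * c\<^sup>2 * card P" using ce by simp
    moreover have "2 * e * card {x \<in> P. R x z} \<le> 2 * e * card P"
      using fin ce by (intro mult_left_mono) (auto intro: card_mono)
    ultimately show ?thesis by linarith
  qed
  ultimately show thesis using that z(1) ce by simp
qed

text \<open>The bound on \<open>d\<close> says \<open>p ^ d \<le> (p / c) ^ (2 * K)\<close>. Then
  the power of \<open>p\<close> in \<open>e\<close> cancels, half of its power of \<open>c\<close>
  is used up, and the rest is at most \<open>c\<^sup>2\<close> since \<open>k * K \<ge> 1\<close>.
  Strictness comes from \<open>k + 1 < 4 * k\<close>.\<close>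

lemma codim_bound_numeric:
  fixes c :: real
  assumes "prime p" "k \<ge> 1" "K > 0" "c > 0" "c \<le> 1"
    and d: "real d \<le> real K * (2 * log (real p) (1 / c) + 2)"
  defines "e \<equiv> c ^ (4 * k * K) / (2 ^ (4 * k) * real p ^ (2 * k * K))"
  shows "2 * e * (2 * real p ^ d) ^ k < c\<^sup>2"
proof -
  have p: "real p > 1" using assms(1) prime_gt_1_nat by simp
  have "real p ^ d = real p powr real d" using p by (simp add: powr_realpow)
  also have "\<dots> \<le> real p powr (real (2 * K) * (log (real p) (1 / c) + 1))"
    using p d by (intro powr_mono) (auto simp: algebra_simps)
  also have "\<dots> = (real p powr (log (real p) (1 / c) + 1)) ^ (2 * K)"
    using p by (simp add: powr_power mult.commute)
  also have "real p powr (log (real p) (1 / c) + 1) = real p / c"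
    using p assms(4) by (simp add: powr_add)
  finally have "(real p ^ d) ^ k \<le> ((real p / c) ^ (2 * K)) ^ k"
    by (intro power_mono) auto
  also have "\<dots> = real p ^ (2 * k * K) / c ^ (2 * k * K)"
    by (simp add: power_divide mult_ac flip: power_mult)
  finally have D: "(real p ^ d) ^ k \<le> real p ^ (2 * k * K) / c ^ (2 * k * K)" .
  have "e > 0" using p assms(4) by (simp add: e_def)
  then have "2 * e * (2 * real p ^ d) ^ k \<le> 2 * e * (2 ^ k * (real p ^ (2 * k * K) / c ^ (2 * k * K)))"
    unfolding power_mult_distrib using D by (intro mult_left_mono) auto
  also have "\<dots> = 2 ^ (k + 1) / 2 ^ (4 * k) * c ^ (2 * k * K)"
  proof -
    have "c ^ (4 * k * K) = c ^ (2 * k * K) * c ^ (2 * k * K)" by (simp add: algebra_simps flip: power_add)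
    then show ?thesis using p assms(4) by (simp add: e_def)
  qed
  also have "\<dots> < 1 * c ^ (2 * k * K)"
  proof (rule mult_strict_right_mono)
    have "(2 :: real) ^ (k + 1) < 2 ^ (4 * k)"
      using assms(2) by (intro power_strict_increasing) auto
    then show "(2 :: real) ^ (k + 1) / 2 ^ (4 * k) < 1" by simp
  qed (use assms(4) in simp)
  also have "\<dots> \<le> c\<^sup>2"
    using assms(2-5) by (simp add: power_decreasing Suc_leI)
  finally show ?thesis .
qed

text \<open>One form for each vector of the finite space \<open>V l\<close> is enough:
  \<open>multilinear_variety\<close> allows any finite number of them, and each uses all variables
  \<open>{1..k}\<close>.\<close>

lemma multilinear_variety_slice:
  assumes \<alpha>: "\<And>y. y \<in> prod_space {1..l} V \<Longrightarrow> multilinear_form p {1..k} U (\<lambda>x. \<alpha> x y)"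
    and z: "z \<in> prod_space {1..l} V" and "k \<ge> 1" "l \<ge> 1" and fin: "finite (carrier (V l))"
  shows "multilinear_variety p k U {x \<in> prod_space {1..k} U. \<forall>v\<in>carrier (V l). \<alpha> x (z(l := v)) = 0}"
proof -
  obtain b n where b: "bij_betw b {0..<n :: nat} (carrier (V l))"
    using ex_bij_betw_nat_finite[OF fin] by blast
  have "multilinear_form p {1..k} U (\<lambda>x. \<alpha> x (z(l := b j)))" if "j < n" for j
  proof (rule \<alpha>)
    have "b j \<in> carrier (V l)" using b that by (auto simp: bij_betw_def)
    then show "z(l := b j) \<in> prod_space {1..l} V"
      using z \<open>l \<ge> 1\<close> by (auto simp: PiE_iff extensional_def)
  qed
  moreover
  have "(\<forall>v\<in>carrier (V l). \<alpha> x (z(l := v)) = 0) \<longleftrightarrow>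
      (\<forall>j<n. \<alpha> (restrict x {1..k}) (z(l := b j)) = \<zero>\<^bsub>Fp p\<^esub>)" if "x \<in> prod_space {1..k} U" for x
  proof -
    have "carrier (V l) = b ` {..<n}" using b by (simp add: bij_betw_def lessThan_atLeast0)
    moreover have "restrict x {1..k} = x" using that by (rule PiE_restrict)
    ultimately show ?thesis by (auto simp: residue_ring_def)
  qed
  then have "{x \<in> prod_space {1..k} U. \<forall>v\<in>carrier (V l). \<alpha> x (z(l := v)) = 0} =
      {x \<in> prod_space {1..k} U. \<forall>j<n. \<alpha> (restrict x {1..k}) (z(l := b j)) = \<zero>\<^bsub>Fp p\<^esub>}"
    by (intro Collect_cong conj_cong refl)
  moreover have "{1..k} \<noteq> {}" using \<open>k \<ge> 1\<close> by simp
  ultimately show ?thesis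
    unfolding multilinear_variety_def variety_by_def
    by (intro exI[of _ n] exI[of _ "\<lambda>_. {1..k}"] exI[of _ "\<lambda>j x. \<alpha> x (z(l := b j))"]) blast
qed

section \<open>A low-codimension subvariety of a dense slice has no points of small bias\<close>

theorem theorem5:
  fixes p k l K :: nat
    and U :: "nat \<Rightarrow> (int, 'a) module"
    and V :: "nat \<Rightarrow> (int, 'b) module"
    and \<alpha> :: "(nat \<Rightarrow> 'a) \<Rightarrow> (nat \<Rightarrow> 'b) \<Rightarrow> int"
    and c c' :: real
  assumes "prime p" and "k \<ge> 1" and "l \<ge> 1"
    and "\<And>i. i \<in> {1..k} \<Longrightarrow> fin_dim_space p (U i)"
    and "\<And>j. j \<in> {1..l} \<Longrightarrow> fin_dim_space p (V j)"
    and "\<And>y. y \<in> prod_space {1..l} V \<Longrightarrow> multilinear_form p {1..k} U (\<lambda>x. \<alpha> x y)"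
    and "\<And>x. x \<in> prod_space {1..k} U \<Longrightarrow> multilinear_form p {1..l} V (\<lambda>y. \<alpha> x y)"
    and "variety_constant k K"
    and "c > 0"
    and "real (card (bias_set p k U l V \<alpha> c)) \<ge> c * real (card (prod_space {1..k} U))"
    and "c' = 2 powr (- real (2 ^ (k + 2) * k)) *
              real p powr (- real (2 ^ (k + 1) * k * K)) *
              c ^ (2 ^ (k + 2) * k * K)"
  shows "\<exists>Z. Z \<subseteq> bias_set p k U l V \<alpha> c' \<and>
             variety_of_codim_le p k U (real K * (2 * log (real p) (1 / c) + 2)) Z"
proof -
  let ?P = "prod_space {1..k} U" and ?Q = "prod_space {1..l} V"
  define f where "f x = Re (bias p {1..l} V (\<alpha> x))" for x
  \<comment> \<open>The entry \<open>z l\<close> is overwritten, so \<open>z\<close> may range over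
    all of \<open>?Q\<close>, and \<open>f x\<close> becomes the proportion of \<open>z\<close> with
    \<open>R x z\<close>.\<close>
  define R where "R x z \<longleftrightarrow> (\<forall>v\<in>carrier (V l). \<alpha> x (z(l := v)) = 0)" for x z
  define e where "e = c ^ (4 * k * K) / (2 ^ (4 * k) * real p ^ (2 * k * K))"
  have p: "p > 0" "real p \<ge> 2" using prime_ge_2_nat[OF assms(1)] by auto
  have l: "l \<in> {1..l}" using assms(3) by simp
  have K: "K > 0" using assms(8) unfolding variety_constant_def by blast
  have e: "e > 0" using p assms(9) by (simp add: e_def)
  have fin: "finite ?P" "finite ?Q"
    using finite_prod_space[of p "{1..k}" U] finite_prod_space[of p "{1..l}" V] p assms(4,5) by auto
  have P_pos: "card ?P > 0"
    using card_carrier_pos[of p "{1..k}" U] p assms(4) by (simp add: card_PiE prod_pos)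
  have Q_ne: "?Q \<noteq> {}"
    using card_carrier_pos[of p "{1..l}" V] p assms(5) by (fastforce simp: PiE_eq_empty_iff)
  have f_eq: "f x = card {z \<in> ?Q. R x z} / card ?Q" if "x \<in> ?P" for x
    using bias_eq_proportion[OF p(1) finite_atLeastAtMost assms(5) assms(7)[OF that] l]
    by (simp add: f_def R_def)
  have S_eq: "bias_set p k U l V \<alpha> \<delta> = {x \<in> ?P. \<delta> \<le> f x}" for \<delta>
    by (simp add: bias_set_def f_def)

  have "real (card (bias_set p k U l V \<alpha> c)) \<le> card ?P"
    unfolding S_eq using fin by (auto intro: card_mono)
  then have "c * card ?P \<le> 1 * card ?P" using assms(10) by simp
  then have c_le: "c \<le> 1" using P_pos by simp

  have "c * card ?P \<le> card {x \<in> ?P. c \<le> card {z \<in> ?Q. R x z} / card ?Q}"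
    using assms(10) f_eq unfolding S_eq by (simp cong: conj_cong)
  from exists_dense_slice_few_bad[OF fin Q_ne assms(9) e this] obtain z where z: "z \<in> ?Q"
    and dense: "c\<^sup>2 * card ?P \<le> 2 * card {x \<in> ?P. R x z}"
    and bad': "c\<^sup>2 * card {x \<in> ?P. R x z \<and> card {z \<in> ?Q. R x z} / card ?Q < e} \<le> 2 * e * card ?P"
    by blast
  have bad: "c\<^sup>2 * card {x \<in> ?P. R x z \<and> f x < e} \<le> 2 * e * card ?P"
    using bad' f_eq by (simp cong: conj_cong)

  define Z where "Z = {x \<in> ?P. R x z}"
  have "multilinear_variety p k U Z"
    unfolding Z_def R_def
    using multilinear_variety_slice[OF assms(6) z assms(2,3) fin_dim_space_finite[OF assms(5)[OF l]]] .
  from variety_constantD[OF assms(8,1,4) this] obtain Y d where Y: "Y \<subseteq> Z" "variety_by p k U d Y"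
    and d: "real d \<le> real K * (log (real p) (1 / density k U Z) + 1)"
    by blast
  have dens: "density k U Z \<ge> c\<^sup>2 / 2"
    using dense P_pos by (simp add: density_def Z_def field_simps)
  have "c\<^sup>2 / 2 > 0" using assms(9) by simp
  then have dens_pos: "density k U Z > 0" using dens by linarith
  with dens have "1 / density k U Z \<le> 2 * (1 / c)\<^sup>2"
    using assms(9) by (simp add: field_simps)
  \<comment> \<open>The factor 2 is absorbed by \<open>p \<ge> 2\<close>. This costs 1 in the
    logarithm and, with the 1 in the bound for \<open>K\<close>, makes up the summand 2 in the
    codimension.\<close>
  also have "\<dots> \<le> real p * (1 / c)\<^sup>2" using p by (intro mult_right_mono) auto
  finally have "log (real p) (1 / density k U Z) \<le> log (real p) (real p * (1 / c)\<^sup>2)"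
    using p dens_pos by (intro log_mono) auto
  also have "\<dots> = 1 + 2 * log (real p) (1 / c)"
    using p assms(9) log_mult_pos[of "real p" "(1 / c)\<^sup>2" "real p"] log_nat_power[of "1 / c" "real p" 2]
    by simp
  finally have "real K * (log (real p) (1 / density k U Z) + 1) \<le>
      real K * (2 * log (real p) (1 / c) + 2)"
    by (intro mult_left_mono) auto
  with d have d: "real d \<le> real K * (2 * log (real p) (1 / c) + 2)"
    by (rule order_trans)

  have f_mult: "f (x(i := u)) * f (x(i := v)) \<le> f (x(i := u \<oplus>\<^bsub>U i\<^esub> v))"
    if x: "x \<in> ?P" and i: "i \<in> {1..k}" and u: "u \<in> carrier (U i)" and v: "v \<in> carrier (U i)" for x i u v
  proof -
    have upd: "multilinear_form p {1..l} V (\<alpha> (x(i := w)))" if "w \<in> carrier (U i)" for w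
      using x i that by (intro assms(7)) (auto simp: PiE_iff extensional_def)
    have "\<alpha> (x(i := u \<oplus>\<^bsub>U i\<^esub> v)) y = (\<alpha> (x(i := u)) y + \<alpha> (x(i := v)) y) mod int p" if "y \<in> ?Q" for y
      using multilinear_form_additive_form[OF assms(6)[OF that] x i] u v
      by (simp add: additive_form_def)
    moreover have "u \<oplus>\<^bsub>U i\<^esub> v \<in> carrier (U i)"
      using abelian_monoid.a_closed[OF abelian_group.axioms(1)[OF fin_dim_space_abelian_group[OF assms(4)[OF i]]] u v] .
    ultimately show ?thesis
      unfolding f_def
      using bias_add_ge[OF p(1) finite_atLeastAtMost assms(5) upd[OF u] upd[OF v] upd l] by blast
  qed

  \<comment> \<open>The bad points are counted at level \<open>e\<close>; undoing the
    \<open>k\<close> halvings of the exponent turns \<open>e\<close> into its power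
    \<open>2 ^ k\<close>, which is \<open>c'\<close>.\<close>
  have e_c': "e ^ (2 ^ k) = c'"
  proof -
    have "e ^ (2 ^ k) = c ^ (4 * k * K * 2 ^ k) / (2 ^ (4 * k * 2 ^ k) * real p ^ (2 * k * K * 2 ^ k))"
      by (simp add: e_def power_divide power_mult_distrib flip: power_mult)
    moreover have "c' = c ^ (2 ^ (k + 2) * k * K) / (2 ^ (2 ^ (k + 2) * k) * real p ^ (2 ^ (k + 1) * k * K))"
      using p unfolding assms(11) powr_minus
      by (simp only: powr_realpow zero_less_numeral of_nat_0_less_iff) (simp add: field_simps)
    ultimately show ?thesis by (simp add: power_add mult_ac)
  qed

  have "x \<in> bias_set p k U l V \<alpha> c'" if x: "x \<in> Y" for x
  proof (rule ccontr)
    assume "x \<notin> bias_set p k U l V \<alpha> c'"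
    then have "f x < e ^ (2 ^ k)"
      using x Y(1) by (auto simp: S_eq e_c' Z_def)
    \<comment> \<open>At level \<open>k\<close> every coordinate is free, so the count compares the
      bad points of \<open>Y\<close>, all of them in the slice, with the whole of \<open>?P\<close>.
      Together with \<open>bad\<close> this contradicts \<open>codim_bound_numeric\<close>.\<close>
    from supermultiplicative_bad_points[OF p(1) assms(4) Y(2) f_mult e order_refl x this]
    have "card ?P \<le> (2 * p ^ d) ^ k * card {y \<in> Y. f y < e \<and> (\<forall>j. j \<notin> {1..k} \<longrightarrow> y j = x j)}"
      by (simp add: card_PiE)
    also have "\<dots> \<le> (2 * p ^ d) ^ k * card {x \<in> ?P. R x z \<and> f x < e}"
      using Y(1) fin by (intro mult_left_mono card_mono) (auto simp: Z_def)
    finally have "real (card ?P) \<le> real ((2 * p ^ d) ^ k * card {x \<in> ?P. R x z \<and> f x < e})"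
      by (rule of_nat_mono)
    then have "c\<^sup>2 * card ?P \<le> c\<^sup>2 * real ((2 * p ^ d) ^ k * card {x \<in> ?P. R x z \<and> f x < e})"
      by (rule mult_left_mono) simp
    also have "\<dots> = (2 * real p ^ d) ^ k * (c\<^sup>2 * card {x \<in> ?P. R x z \<and> f x < e})"
      by (simp only: of_nat_mult of_nat_power of_nat_numeral mult_ac)
    also have "\<dots> \<le> (2 * real p ^ d) ^ k * (2 * e * card ?P)"
      using bad by (intro mult_left_mono) auto
    also have "\<dots> = 2 * e * (2 * real p ^ d) ^ k * card ?P"
      by (simp only: mult_ac)
    finally have "c\<^sup>2 \<le> 2 * e * (2 * real p ^ d) ^ k"
      using P_pos by (simp only: mult_le_cancel_right_pos of_nat_0_less_iff)
    with codim_bound_numeric[OF assms(1,2) K assms(9) c_le d] show False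
      unfolding e_def by linarith
  qed
  then show ?thesis
    using Y(2) d unfolding variety_of_codim_le_def by blast
qed

end
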